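(* For $n\ge1$ and $0\le p\le n-1$ let $C_{n,p}$ be the number of configurations of size $n$ in which exactly $p$ other pairs are contained by the given pair, and let $\mathcal C_n(p)=C_{n,p}/(n\,(2n-1)!!)$. Define the asymptotic distribution $\mathcal C(x)=\lim_{n\to\infty}(n-1)\,\mathcal C_n\bigl((n-1)x\bigr)$ for $x=\lim_{n\to\infty}p/(n-1)\in[0,1]$. Then $$\mathcal C(x)=\frac{1}{\sqrt{x}}-1,\qquad 0<x\le 1.$$
   Context: Fix $n\ge1$. A configuration (of size $n$) is a perfect matching of the $2n$ points $1,2,\dots,2n$ (laid out on a line) into $n$ unordered pairs, together with one distinguished pair, called the given pair; the other $n-1$ pairs are treated as indistinguishable, so there are $n\,(2n-1)!!$ configurations. Let the given pair be $\{g<h\}$ and let $\{a<b\}$ be another pair. The pair $\{a,b\}$ is contained by the given pair if $g<a<b<h$. *)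

theory Defs
  imports Complex_Main "HOL-Library.Disjoint_Sets"
begin

definition perfect_matchings :: "nat set \<Rightarrow> nat set set set" where
  "perfect_matchings V = {M. partition_on V M \<and> (\<forall>e\<in>M. card e = 2)}"

definition configurations :: "nat \<Rightarrow> (nat set set \<times> nat set) set" where
  "configurations n = {(M, G). M \<in> perfect_matchings {1..2 * n} \<and> G \<in> M}"

definition contained_by :: "nat set \<Rightarrow> nat set \<Rightarrow> bool" where
  "contained_by e G \<longleftrightarrow>
     (\<exists>g h a b. G = {g, h} \<and> e = {a, b} \<and> g < a \<and> a < b \<and> b < h)"

definition num_contained :: "nat set set \<Rightarrow> nat set \<Rightarrow> nat" where
  "num_contained M G = card {e \<in> M - {G}. contained_by e G}"

definition containment_count :: "nat \<Rightarrow> nat \<Rightarrow> nat" where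
  "containment_count n p = card {(M, G) \<in> configurations n. num_contained M G = p}"

text \<open>\<open>odd_double_fact n\<close> is $(2n-1)!! = 1 \cdot 3 \cdots (2n-1)$.\<close>

definition odd_double_fact :: "nat \<Rightarrow> nat" where
  "odd_double_fact n = (\<Prod>i<n. 2 * i + 1)"

definition containment_dist :: "nat \<Rightarrow> nat \<Rightarrow> real" where
  "containment_dist n p =
     real (containment_count n p) / (real n * real (odd_double_fact n))"

end

theory Submission
  imports Defs
begin

text \<open>
  The counts have the closed form $C_{n,p} = (2p-1)!!\,(2n)!!/(2p)!! - (2n-1)!!$. The pair of the
  rightmost point is contained in no other pair, so removing it gives
  $C_{n,p} = (2n-1)\,C_{n-1,p} + E_{n,p}$, where $E_{n,p}$ counts the configurations whose given
  pair ends at the rightmost point. The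
  pair of the leftmost point is never contained in the given pair, and if it is the given pair of
  such a configuration, then it contains all other pairs; hence
  $E_{n,p} = (2n-2)\,E_{n-1,p}$ for $p < n-1$ and $E_{n,n-1} = (2n-3)!!$, that is,
  $E_{n,p} = (2p-1)!!\,(2n-2)!!/(2p)!!$ for $p < n$. With $w_n = (2n-1)!!/(2n)!!$ this says
  $\mathcal C_n(p) = (w_p/w_n - 1)/n$, and $w_p/w_n \to 1/\sqrt x$ because $n w_n^2$ has a positive
  limit. All counts are made on arbitrary finite sets of naturals, so that removing a pair needs no
  relabelling.
\<close>

section \<open>Perfect matchings of a finite set, sorted by the partner of a fixed point\<close>

lemma perfect_matchings_empty: "perfect_matchings {} = {{}}"
  by (auto simp: perfect_matchings_def partition_on_def)

lemma perfect_matchings_subset: "M \<in> perfect_matchings V \<Longrightarrow> e \<in> M \<Longrightarrow> e \<subseteq> V"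
  by (auto simp: perfect_matchings_def partition_on_def)

lemma finite_perfect_matchings: "finite V \<Longrightarrow> finite (perfect_matchings V)"
  by (rule finite_subset[of _ "Pow (Pow V)"])
     (auto simp: perfect_matchings_def partition_on_def)

lemma finite_perfect_matching: "finite V \<Longrightarrow> M \<in> perfect_matchings V \<Longrightarrow> finite M"
  using perfect_matchings_subset by (meson PowI finite_Pow_iff finite_subset subsetI)

lemma card_perfect_matching:
  assumes "finite V" "M \<in> perfect_matchings V"
  shows "2 * card M = card V"
proof -
  have "card (\<Union>M) = 2 * card M"
    using assms card_partition[of M 2] finite_perfect_matching[OF assms]
    by (auto simp: perfect_matchings_def partition_on_def disjoint_def)
  then show ?thesis
    using assms by (auto simp: perfect_matchings_def partition_on_def)
qed

lemma insert_perfect_matching: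
  assumes "u \<in> V" "v \<in> V" "u \<noteq> v" "M \<in> perfect_matchings (V - {u, v})"
  shows "insert {u, v} M \<in> perfect_matchings V"
  using assms
  by (auto simp: perfect_matchings_def partition_on_def disjoint_def)

lemma remove_perfect_matching:
  assumes "M \<in> perfect_matchings V" "e \<in> M"
  shows "M - {e} \<in> perfect_matchings (V - e)"
  using assms
  by (fastforce simp: perfect_matchings_def partition_on_def disjoint_def)

text \<open>The partner \<open>u\<close> of \<open>v\<close> can be read off from the matching,
  because no pair of \<open>M\<close> meets \<open>v\<close>; deleting the pair of \<open>v\<close>
  leaves a matching of \<open>V - {u, v}\<close>.\<close>

lemma bij_betw_insert_pair:
  assumes "v \<in> V"
  shows "bij_betw (\<lambda>(u, M). insert {u, v} M)
    (SIGMA u:V - {v}. perfect_matchings (V - {u, v})) (perfect_matchings V)"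
  unfolding bij_betw_def
proof
  have notin: "v \<notin> e" "e \<noteq> {u, v}" if "M \<in> perfect_matchings (V - {u, v})" "e \<in> M" for u M e
    using perfect_matchings_subset[OF that] by auto
  show "inj_on (\<lambda>(u, M). insert {u, v} M)
      (SIGMA u:V - {v}. perfect_matchings (V - {u, v}))"
  proof (rule inj_onI)
    fix x y
    assume *: "x \<in> (SIGMA u:V - {v}. perfect_matchings (V - {u, v}))"
      "y \<in> (SIGMA u:V - {v}. perfect_matchings (V - {u, v}))"
      "(\<lambda>(u, M). insert {u, v} M) x = (\<lambda>(u, M). insert {u, v} M) y"
    obtain u M u' M' where xy: "x = (u, M)" "y = (u', M')" by (meson surj_pair)
    have u: "u \<noteq> v" "u' \<noteq> v"
      and M: "M \<in> perfect_matchings (V - {u, v})" "M' \<in> perfect_matchings (V - {u', v})"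
      and eq: "insert {u, v} M = insert {u', v} M'"
      using * xy by auto
    have "{u, v} \<in> insert {u', v} M'" using eq by blast
    then have "{u, v} = {u', v}" using notin(1)[OF M(2)] by auto
    then have "u = u'" using u by (auto simp: doubleton_eq_iff)
    moreover have "{u, v} \<notin> M" "{u', v} \<notin> M'" using notin(1) M by blast+
    ultimately show "x = y" using eq xy by (auto simp: insert_ident)
  qed
  show "(\<lambda>(u, M). insert {u, v} M) ` (SIGMA u:V - {v}. perfect_matchings (V - {u, v}))
      = perfect_matchings V"
  proof (intro equalityI subsetI)
    fix M assume M: "M \<in> perfect_matchings V"
    then obtain e where e: "e \<in> M" "v \<in> e"
      using assms by (auto simp: perfect_matchings_def partition_on_def)
    with M have "card e = 2" by (auto simp: perfect_matchings_def)
    with e obtain u where u: "e = {u, v}" "u \<noteq> v"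
      by (metis card_2_iff doubleton_eq_iff insertE singletonD)
    then have "u \<in> V" using perfect_matchings_subset[OF M e(1)] by auto
    moreover have "M - {e} \<in> perfect_matchings (V - {u, v})"
      using remove_perfect_matching[OF M e(1)] u by simp
    moreover have "M = insert {u, v} (M - {e})" using e u by auto
    ultimately show "M \<in> (\<lambda>(u, M). insert {u, v} M) `
        (SIGMA u:V - {v}. perfect_matchings (V - {u, v}))"
      using u by (intro image_eqI[of _ _ "(u, M - {e})"]) auto
  qed (use assms insert_perfect_matching in auto)
qed

text \<open>The bijection in summation form. The recurrences for the two configuration counts take
  \<open>v\<close> to be the least or the greatest point of \<open>V\<close>.\<close>

lemma sum_perfect_matchings:
  fixes f :: "nat set set \<Rightarrow> 'a :: comm_monoid_add"
  assumes "finite V" "v \<in> V"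
  shows "(\<Sum>M\<in>perfect_matchings V. f M) =
    (\<Sum>u\<in>V - {v}. \<Sum>M\<in>perfect_matchings (V - {u, v}). f (insert {u, v} M))"
proof -
  have "(\<Sum>M\<in>perfect_matchings V. f M) =
      (\<Sum>(u, M)\<in>(SIGMA u:V - {v}. perfect_matchings (V - {u, v})). f (insert {u, v} M))"
    using sum.reindex_bij_betw[OF bij_betw_insert_pair[OF assms(2)], of f]
    by (simp add: case_prod_unfold)
  then show ?thesis
    using assms by (simp add: sum.Sigma finite_perfect_matchings)
qed

lemma card_Diff_pair:
  assumes "finite V" "v \<in> V" "u \<in> V - {v}" "card V = 2 * Suc n"
  shows "card (V - {u, v}) = 2 * n"
  using assms by (simp add: card_Diff_subset)

lemma card_perfect_matchings:
  "finite V \<Longrightarrow> card V = 2 * n \<Longrightarrow> card (perfect_matchings V) = odd_double_fact n"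
proof (induction n arbitrary: V)
  case 0
  then show ?case by (simp add: perfect_matchings_empty odd_double_fact_def)
next
  case (Suc n)
  then obtain v where v: "v \<in> V" by fastforce
  have "card (perfect_matchings V) = (\<Sum>u\<in>V - {v}. card (perfect_matchings (V - {u, v})))"
    using sum_perfect_matchings[OF Suc.prems(1) v, of "\<lambda>_. 1 :: nat"] by simp
  also have "\<dots> = (\<Sum>u\<in>V - {v}. odd_double_fact n)"
    using Suc.IH Suc.prems(1) card_Diff_pair[OF Suc.prems(1) v _ Suc.prems(2)]
    by (intro sum.cong) auto
  also have "\<dots> = odd_double_fact (Suc n)"
    using Suc.prems v by (simp add: odd_double_fact_def)
  finally show ?case .
qed

section \<open>Containment of pairs through an extreme point\<close>

lemma contained_by_between:
  "contained_by e G \<Longrightarrow> w \<in> e \<Longrightarrow> \<exists>g\<in>G. \<exists>h\<in>G. g < w \<and> w < h"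
  unfolding contained_by_def by fastforce

text \<open>Containment would put \<open>w\<close> strictly between two points of \<open>G\<close>,
  hence of \<open>V\<close>, which an extreme \<open>w\<close> forbids. Since \<open>w\<close> may
  lie outside \<open>V\<close>, the lemma can be applied to the point set left after deleting
  \<open>e\<close>.\<close>

lemma num_contained_insert:
  assumes "G \<subseteq> V" "w \<in> e" "(\<forall>z\<in>V. z \<le> w) \<or> (\<forall>z\<in>V. w \<le> z)"
  shows "num_contained (insert e M) G = num_contained M G"
proof -
  have "\<not> contained_by e G"
    using contained_by_between[OF _ assms(2)] assms by (meson leD subsetD)
  then have "{e' \<in> insert e M - {G}. contained_by e' G} = {e' \<in> M - {G}. contained_by e' G}"
    by auto
  then show ?thesis by (simp add: num_contained_def)
qed

text \<open>All remaining points lie strictly between \<open>l\<close> and \<open>v\<close>, so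
  every pair of \<open>M\<close> is contained.\<close>

lemma num_contained_outermost:
  assumes "finite V" "l \<in> V" "v \<in> V" "l \<noteq> v" "\<forall>z\<in>V. l \<le> z" "\<forall>z\<in>V. z \<le> v"
    and M: "M \<in> perfect_matchings (V - {l, v})"
  shows "num_contained (insert {l, v} M) {l, v} = card M"
proof -
  have "contained_by e {l, v} \<and> e \<noteq> {l, v}" if "e \<in> M" for e
  proof -
    have sub: "e \<subseteq> V - {l, v}" using M that by (rule perfect_matchings_subset)
    have "card e = 2" using M that by (auto simp: perfect_matchings_def)
    then obtain a b where "e = {a, b}" "a < b"
      by (metis card_2_iff insert_commute linorder_neqE_nat)
    moreover from this have "l < a" "b < v"
      using sub assms by (auto simp: order.strict_iff_order)
    ultimately show ?thesis using sub unfolding contained_by_def by blast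
  qed
  then have "{e \<in> insert {l, v} M - {{l, v}}. contained_by e {l, v}} = M" by blast
  then show ?thesis by (simp add: num_contained_def)
qed

section \<open>Recurrences and closed forms for the counts\<close>

definition containing_count :: "nat set \<Rightarrow> nat \<Rightarrow> nat" where
  "containing_count V p = (\<Sum>M\<in>perfect_matchings V. card {G \<in> M. num_contained M G = p})"

text \<open>This is $E_{n,p}$ for \<open>card V = 2 * n\<close>. Like
  \<open>containing_count\<close> it is a sum over matchings, not the size of a set of
  configurations, so that \<open>sum_perfect_matchings\<close> applies.\<close>

definition right_end_count :: "nat set \<Rightarrow> nat \<Rightarrow> nat" where
  "right_end_count V p =
    (\<Sum>M\<in>perfect_matchings V. card {G \<in> M. Max V \<in> G \<and> num_contained M G = p})"

lemma containment_count_eq: "containment_count n p = containing_count {1..2 * n} p"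
proof -
  have "{(M, G) \<in> configurations n. num_contained M G = p} =
      (SIGMA M:perfect_matchings {1..2 * n}. {G \<in> M. num_contained M G = p})"
    by (auto simp: configurations_def)
  then show ?thesis
    unfolding containment_count_def containing_count_def
    using finite_perfect_matching[of "{1..2 * n}"]
    by (simp add: card_SigmaI finite_perfect_matchings)
qed

text \<open>Sort by the partner \<open>u\<close> of the leftmost point. If \<open>u\<close> is not
  the rightmost point, this pair is neither given nor contained and can be deleted; if it is, the
  pair is the given one and contains all \<open>n\<close> others.\<close>

lemma right_end_count_step:
  assumes fin: "finite V" and card: "card V = 2 * Suc n"
  shows "right_end_count V p =
    (\<Sum>u\<in>V - {Min V} - {Max V}. right_end_count (V - {u, Min V}) p) +
    (if p = n then odd_double_fact n else 0)"
proof -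
  define l v where "l = Min V" and "v = Max V"
  have ne: "V \<noteq> {}" using card by auto
  have lv: "l \<in> V" "v \<in> V" "\<forall>z\<in>V. l \<le> z" "\<forall>z\<in>V. z \<le> v"
    using fin ne by (auto simp: l_def v_def)
  have "l \<noteq> v"
  proof
    assume "l = v"
    then have "V \<subseteq> {l}" using lv by force
    then show False using card card_mono[of "{l}" V] by simp
  qed
  define f where "f M = card {G \<in> M. v \<in> G \<and> num_contained M G = p}" for M
  have inner: "(\<Sum>M\<in>perfect_matchings (V - {u, l}). f (insert {u, l} M)) =
      right_end_count (V - {u, l}) p" if u: "u \<in> V - {l} - {v}" for u
  proof -
    \<comment> \<open>The rightmost point survives the deletion, so the smaller count refers to the
      same right end.\<close>
    have "Max (V - {u, l}) = v"
      using fin lv \<open>l \<noteq> v\<close> u by (intro Max_eqI) auto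
    moreover have "f (insert {u, l} M) = card {G \<in> M. v \<in> G \<and> num_contained M G = p}"
      if M: "M \<in> perfect_matchings (V - {u, l})" for M
    proof -
      have "{G \<in> insert {u, l} M. v \<in> G \<and> num_contained (insert {u, l} M) G = p} =
          {G \<in> M. v \<in> G \<and> num_contained M G = p}"
        using u \<open>l \<noteq> v\<close> perfect_matchings_subset[OF M] lv
          num_contained_insert[of _ "V - {u, l}" l "{u, l}" M]
        by auto
      then show ?thesis by (simp add: f_def)
    qed
    ultimately show ?thesis by (simp add: right_end_count_def)
  qed
  have outer: "(\<Sum>M\<in>perfect_matchings (V - {v, l}). f (insert {v, l} M)) =
      (if p = n then odd_double_fact n else 0)"
  proof -
    have card': "card (V - {v, l}) = 2 * n"
      using card_Diff_pair[OF fin lv(1) _ card, of v] lv \<open>l \<noteq> v\<close> by auto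
    have "f (insert {v, l} M) = (if p = n then 1 else 0)"
      if M: "M \<in> perfect_matchings (V - {v, l})" for M
    proof -
      have "num_contained (insert {v, l} M) {v, l} = n"
        using num_contained_outermost[OF fin lv(1,2) \<open>l \<noteq> v\<close> lv(3,4), of M] M
          card_perfect_matching[OF _ M] fin card'
        by (simp add: insert_commute)
      then have "{G \<in> insert {v, l} M. v \<in> G \<and> num_contained (insert {v, l} M) G = p} =
          (if p = n then {{v, l}} else {})"
        using perfect_matchings_subset[OF M] by auto
      then show ?thesis by (simp add: f_def)
    qed
    then show ?thesis
      using card_perfect_matchings[OF _ card'] fin by simp
  qed
  have "right_end_count V p = (\<Sum>M\<in>perfect_matchings V. f M)"
    by (simp add: right_end_count_def f_def v_def)
  also have "\<dots> = (\<Sum>u\<in>V - {l}. \<Sum>M\<in>perfect_matchings (V - {u, l}). f (insert {u, l} M))"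
    by (rule sum_perfect_matchings[OF fin lv(1)])
  also have "\<dots> = (\<Sum>u\<in>V - {l} - {v}. right_end_count (V - {u, l}) p) +
      (if p = n then odd_double_fact n else 0)"
    using inner outer fin lv \<open>l \<noteq> v\<close> by (subst sum.remove[of _ v]) auto
  finally show ?thesis by (simp add: l_def v_def)
qed

lemma card_Diff_Min_Max:
  fixes V :: "nat set"
  assumes "finite V" "card V = 2 * Suc n"
  shows "card (V - {Min V} - {Max V}) = 2 * n"
proof -
  have ne: "V \<noteq> {}" using assms by auto
  have "Min V \<noteq> Max V"
  proof
    assume "Min V = Max V"
    then have "V \<subseteq> {Min V}"
      using assms(1) by (metis Max_ge Min_le antisym singletonI subsetI)
    then show False using assms card_mono[of "{Min V}" V] by simp
  qed
  then show ?thesis using assms ne by simp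
qed

text \<open>Multiplying by $2^p p! = (2p)!!$ keeps the identity in the naturals. In the induction
  the leftmost point has \<open>2 * Suc n\<close> partners other than the rightmost one; the value
  \<open>p = Suc n\<close> comes only from the extra term of the recurrence.\<close>

lemma right_end_count_closed:
  assumes "finite V" "card V = 2 * Suc n"
  shows "right_end_count V p * (2 ^ p * fact p) =
    (if p \<le> n then odd_double_fact p * (2 ^ n * fact n) else 0)"
  using assms
proof (induction n arbitrary: V)
  case (0 V)
  then have "V - {Min V} - {Max V} = {}"
    using card_Diff_Min_Max[OF 0] by simp
  then show ?case using right_end_count_step[OF 0, of p]
    by (simp only: sum.empty) (simp add: odd_double_fact_def)
next
  case (Suc n V)
  let ?K = "2 ^ p * fact p :: nat"
  have "Min V \<in> V" using Suc.prems by (intro Min_in) auto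
  then have "right_end_count (V - {u, Min V}) p * ?K =
      (if p \<le> n then odd_double_fact p * (2 ^ n * fact n) else 0)"
    if "u \<in> V - {Min V} - {Max V}" for u
    using that Suc.IH[of "V - {u, Min V}"] Suc.prems
      card_Diff_pair[OF Suc.prems(1) _ _ Suc.prems(2), of "Min V" u]
    by simp
  then have "(\<Sum>u\<in>V - {Min V} - {Max V}. right_end_count (V - {u, Min V}) p) * ?K =
      2 * Suc n * (if p \<le> n then odd_double_fact p * (2 ^ n * fact n) else 0)"
    using card_Diff_Min_Max[OF Suc.prems] by (simp add: sum_distrib_right del: card_Diff_insert)
  then have "right_end_count V p * ?K =
      2 * Suc n * (if p \<le> n then odd_double_fact p * (2 ^ n * fact n) else 0) +
      (if p = Suc n then odd_double_fact (Suc n) else 0) * ?K"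
    unfolding right_end_count_step[OF Suc.prems] add_mult_distrib by (rule arg_cong)
  then show ?case by (cases "p = Suc n") (auto simp: algebra_simps)
qed

text \<open>If the given pair avoids the rightmost point, the pair of that point can be deleted
  without changing the number of contained pairs; the other configurations are those of
  \<open>right_end_count\<close>.\<close>

lemma containing_count_step:
  assumes fin: "finite V" and "V \<noteq> {}"
  shows "containing_count V p =
    (\<Sum>u\<in>V - {Max V}. containing_count (V - {u, Max V}) p) + right_end_count V p"
proof -
  define v where "v = Max V"
  have v: "v \<in> V" "\<forall>z\<in>V. z \<le> v" using assms by (auto simp: v_def)
  define f where "f M = card {G \<in> M. v \<notin> G \<and> num_contained M G = p}" for M
  have "card {G \<in> M. num_contained M G = p} =
      f M + card {G \<in> M. v \<in> G \<and> num_contained M G = p}"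
    if M: "M \<in> perfect_matchings V" for M
  proof -
    have "{G \<in> M. num_contained M G = p} = {G \<in> M. v \<notin> G \<and> num_contained M G = p} \<union>
        {G \<in> M. v \<in> G \<and> num_contained M G = p}" by auto
    then show ?thesis
      using finite_perfect_matching[OF fin M] unfolding f_def
      by (simp only:) (rule card_Un_disjoint; auto)
  qed
  then have "containing_count V p = (\<Sum>M\<in>perfect_matchings V. f M) + right_end_count V p"
    by (simp add: containing_count_def right_end_count_def v_def sum.distrib)
  also have "(\<Sum>M\<in>perfect_matchings V. f M) =
      (\<Sum>u\<in>V - {v}. \<Sum>M\<in>perfect_matchings (V - {u, v}). f (insert {u, v} M))"
    by (rule sum_perfect_matchings[OF fin v(1)])
  also have "\<dots> = (\<Sum>u\<in>V - {v}. containing_count (V - {u, v}) p)"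
    unfolding containing_count_def
  proof (intro sum.cong refl)
    fix u M assume M: "M \<in> perfect_matchings (V - {u, v})"
    have "{G \<in> insert {u, v} M. v \<notin> G \<and> num_contained (insert {u, v} M) G = p} =
        {G \<in> M. num_contained M G = p}"
      using perfect_matchings_subset[OF M] v
        num_contained_insert[of _ "V - {u, v}" v "{u, v}" M]
      by auto
    then show "f (insert {u, v} M) = card {G \<in> M. num_contained M G = p}"
      by (simp add: f_def)
  qed
  finally show ?thesis by (simp add: v_def)
qed

text \<open>The term $(2n-1)!!$ is added on the left to avoid subtraction of naturals. The branch
  \<open>p > n\<close> states that the count is zero.\<close>

lemma containing_count_closed:
  assumes "finite V" "card V = 2 * n"
  shows "(containing_count V p + odd_double_fact n) * (2 ^ p * fact p) =
    (if p \<le> n then odd_double_fact p * (2 ^ n * fact n)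
     else odd_double_fact n * (2 ^ p * fact p))"
  using assms
proof (induction n arbitrary: V)
  case (0 V)
  then show ?case
    by (simp add: containing_count_def perfect_matchings_empty)
next
  case (Suc n V)
  let ?K = "2 ^ p * fact p :: nat"
  let ?A = "if p \<le> n then odd_double_fact p * (2 ^ n * fact n)
     else odd_double_fact n * (2 ^ p * fact p)"
  have "V \<noteq> {}" using Suc.prems by auto
  then have v: "Max V \<in> V" using Suc.prems by simp
  have odd: "odd_double_fact (Suc n) = (2 * n + 1) * odd_double_fact n"
    by (simp add: odd_double_fact_def)
  \<comment> \<open>There are \<open>2 * n + 1\<close> choices of \<open>u\<close>, so adding
    \<open>odd_double_fact n\<close> to each summand adds \<open>odd_double_fact (Suc n)\<close> in
    total and matches the induction hypothesis.\<close>
  have "(\<Sum>u\<in>V - {Max V}. containing_count (V - {u, Max V}) p + odd_double_fact n) * ?K =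
      (\<Sum>u\<in>V - {Max V}. ?A)"
    unfolding sum_distrib_right
    using Suc.IH Suc.prems card_Diff_pair[OF Suc.prems(1) v _ Suc.prems(2)]
    by (intro sum.cong) auto
  then have "((\<Sum>u\<in>V - {Max V}. containing_count (V - {u, Max V}) p)
      + odd_double_fact (Suc n)) * ?K = (2 * n + 1) * ?A"
    using Suc.prems v unfolding odd by (simp add: sum.distrib)
  then have "(containing_count V p + odd_double_fact (Suc n)) * ?K =
      (2 * n + 1) * ?A + right_end_count V p * ?K"
    using containing_count_step[OF Suc.prems(1) \<open>V \<noteq> {}\<close>, of p]
    by (simp add: algebra_simps)
  \<comment> \<open>For \<open>p \<le> n\<close> the factors \<open>2 * n + 1\<close> and 1 add up
    to \<open>2 * Suc n\<close>. For \<open>p = Suc n\<close> the right end count vanishes and both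
    branches of the claim agree.\<close>
  also have "\<dots> = (if p \<le> Suc n then odd_double_fact p * (2 ^ Suc n * fact (Suc n))
     else odd_double_fact (Suc n) * (2 ^ p * fact p))"
    unfolding right_end_count_closed[OF Suc.prems] odd
    by (auto simp: algebra_simps le_Suc_eq odd_double_fact_def)
  finally show ?case .
qed

section \<open>The Wallis ratio $w_n = (2n-1)!!/(2n)!!$, equal to $4^{-n}$ times the central
  binomial coefficient\<close>

definition wallis_ratio :: "nat \<Rightarrow> real" where
  "wallis_ratio n = real (odd_double_fact n) / (2 ^ n * fact n)"

lemma wallis_ratio_Suc:
  "wallis_ratio (Suc n) = wallis_ratio n * ((2 * real n + 1) / (2 * real n + 2))"
  by (simp add: wallis_ratio_def odd_double_fact_def divide_simps) (simp add: algebra_simps)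

lemma odd_double_fact_pos: "odd_double_fact n > 0"
  by (auto simp: odd_double_fact_def intro!: prod_pos)

lemma wallis_ratio_pos: "wallis_ratio n > 0"
  using odd_double_fact_pos by (simp add: wallis_ratio_def)

text \<open>The closed form divided by $(2p)!!$ and by $n (2n-1)!!$. At \<open>n = 0\<close> both
  sides are 0 by the convention for division by zero.\<close>

lemma containment_dist_closed:
  assumes "p \<le> n"
  shows "containment_dist n p = (wallis_ratio p / wallis_ratio n - 1) / real n"
proof -
  have "(containment_count n p + odd_double_fact n) * (2 ^ p * fact p) =
      odd_double_fact p * (2 ^ n * fact n)"
    using containing_count_closed[of "{1..2 * n}" n p] assms
    by (simp add: containment_count_eq)
  then have "(real (containment_count n p) + real (odd_double_fact n)) * (2 ^ p * fact p) =
      real (odd_double_fact p) * (2 ^ n * fact n)"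
    by (metis (mono_tags, lifting) of_nat_add of_nat_fact of_nat_mult of_nat_numeral of_nat_power)
  then have "real (containment_count n p) =
      real (odd_double_fact p) * (2 ^ n * fact n) / (2 ^ p * fact p) - real (odd_double_fact n)"
    by (simp add: eq_divide_eq eq_diff_eq)
  then show ?thesis
    using odd_double_fact_pos[of n]
    by (simp add: containment_dist_def wallis_ratio_def diff_divide_distrib mult_ac)
qed

text \<open>Monotone convergence: $n w_n^2$ increases, while $(2n+1) w_n^2$ decreases from 1 and
  bounds it.\<close>

lemma wallis_ratio_limit:
  obtains L where "L > 0" "(\<lambda>n. real n * (wallis_ratio n)\<^sup>2) \<longlonglongrightarrow> L"
proof -
  let ?a = "\<lambda>n. real n * (wallis_ratio n)\<^sup>2"
  have "?a n \<le> ?a (Suc n)" for n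
  proof -
    have "real n \<le> (2 * real n + 1)\<^sup>2 / (4 * (real n + 1))"
      by (simp add: field_simps power2_eq_square)
    also have "\<dots> = real (Suc n) * ((2 * real n + 1) / (2 * real n + 2))\<^sup>2"
      by (simp add: divide_simps power2_eq_square) (simp add: algebra_simps)
    finally have "?a n \<le> real (Suc n) * ((2 * real n + 1) / (2 * real n + 2))\<^sup>2 * (wallis_ratio n)\<^sup>2"
      by (rule mult_right_mono) simp
    then show ?thesis by (simp only: wallis_ratio_Suc power_mult_distrib mult_ac)
  qed
  then have inc: "incseq ?a" by (rule incseq_SucI)
  have bound: "(2 * real n + 1) * (wallis_ratio n)\<^sup>2 \<le> 1" for n
  proof (induction n)
    case 0
    then show ?case by (simp add: wallis_ratio_def odd_double_fact_def)
  next
    case (Suc n)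
    have "(2 * real (Suc n) + 1) * ((2 * real n + 1) / (2 * real n + 2))\<^sup>2 \<le> 2 * real n + 1"
      by (simp add: divide_simps power2_eq_square) (simp add: algebra_simps)
    then have "(2 * real (Suc n) + 1) * ((2 * real n + 1) / (2 * real n + 2))\<^sup>2 * (wallis_ratio n)\<^sup>2
        \<le> (2 * real n + 1) * (wallis_ratio n)\<^sup>2"
      by (rule mult_right_mono) simp
    with Suc show ?case by (simp only: wallis_ratio_Suc power_mult_distrib mult_ac)
  qed
  have "?a n \<le> 1" for n
    using bound[of n] mult_right_mono[of "real n" "2 * real n + 1" "(wallis_ratio n)\<^sup>2"] by simp
  then obtain L where L: "?a \<longlonglongrightarrow> L" "\<forall>i. ?a i \<le> L"
    using incseq_convergent[OF inc] by blast
  \<comment> \<open>The limit dominates every term; index 1 is the first with a positive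
    one.\<close>
  have "0 < ?a 1" using wallis_ratio_pos[of 1] by simp
  with L(2) have "L > 0" by (meson less_le_trans)
  with L(1) show thesis using that by blast
qed

section \<open>Passage to the limit\<close>

theorem theorem15:
  fixes x :: real and p :: "nat \<Rightarrow> nat"
  assumes "0 < x" and "x \<le> 1"
    and "\<And>n. n \<ge> 1 \<Longrightarrow> p n \<le> n - 1"
    and "(\<lambda>n. real (p n) / (real n - 1)) \<longlonglongrightarrow> x"
  shows "(\<lambda>n. (real n - 1) * containment_dist n (p n)) \<longlonglongrightarrow> 1 / sqrt x - 1"
proof -
  let ?w = wallis_ratio
  let ?a = "\<lambda>n. real n * (?w n)\<^sup>2"
  obtain L where L: "L > 0" "?a \<longlonglongrightarrow> L" by (rule wallis_ratio_limit)
  have shift: "filterlim (\<lambda>n. real n - 1) at_top sequentially"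
    using filterlim_tendsto_add_at_top[OF tendsto_const[of "-1"] filterlim_real_sequentially]
    by simp
  have n1: "(\<lambda>n. (real n - 1) / real n) \<longlonglongrightarrow> 1"
  proof -
    have "(\<lambda>n. 1 - 1 / real n) \<longlonglongrightarrow> 1"
      using tendsto_diff[OF tendsto_const lim_const_over_n[of 1], of "1 :: real"] by simp
    then show ?thesis
      by (rule Lim_transform_eventually)
         (auto simp: diff_divide_distrib intro!: eventually_mono[OF eventually_gt_at_top[of 0]])
  qed
  \<comment> \<open>Since \<open>x > 0\<close>, \<open>p n\<close> tends to infinity, so the limit
    \<open>L\<close> also holds along \<open>p n\<close>.\<close>
  have "filterlim (\<lambda>n. real (p n) / (real n - 1) * (real n - 1)) at_top sequentially"
    by (rule filterlim_tendsto_pos_mult_at_top[OF assms(4,1) shift])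
  moreover have "\<forall>\<^sub>F n in sequentially. real (p n) / (real n - 1) * (real n - 1) = real (p n)"
    using eventually_gt_at_top[of 1] by eventually_elim simp
  ultimately have "filterlim (\<lambda>n. real (p n)) at_top sequentially"
    by (metis (mono_tags) filterlim_cong)
  then have ptop: "filterlim p at_top sequentially"
    by (simp add: filterlim_sequentially_iff_filterlim_real)
  \<comment> \<open>The last factor is \<open>n / p n\<close>, written through quotients with known
    limits; it removes the linear factors of \<open>?a\<close> and leaves the squared ratio of the
    \<open>?w\<close>. The two limits \<open>L\<close> cancel.\<close>
  have "(\<lambda>n. ?a (p n) / ?a n * (inverse ((real n - 1) / real n) / (real (p n) / (real n - 1))))
      \<longlonglongrightarrow> L / L * (inverse 1 / x)"
    using L assms(1) by (intro tendsto_intros assms(4) n1 filterlim_compose[OF L(2) ptop]) auto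
  moreover have "\<forall>\<^sub>F n in sequentially. ?a (p n) / ?a n *
      (inverse ((real n - 1) / real n) / (real (p n) / (real n - 1))) = (?w (p n) / ?w n)\<^sup>2"
    using eventually_gt_at_top[of 1] ptop[unfolded filterlim_at_top, rule_format, of 1]
  proof eventually_elim
    case (elim n)
    then show ?case
      using wallis_ratio_pos[of n] by (simp add: field_simps)
  qed
  ultimately have "(\<lambda>n. (?w (p n) / ?w n)\<^sup>2) \<longlonglongrightarrow> L / L * (inverse 1 / x)"
    by (rule Lim_transform_eventually)
  then have "(\<lambda>n. (?w (p n) / ?w n)\<^sup>2) \<longlonglongrightarrow> 1 / x"
    using L(1) by simp
  then have "(\<lambda>n. sqrt ((?w (p n) / ?w n)\<^sup>2)) \<longlonglongrightarrow> sqrt (1 / x)"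
    by (rule tendsto_real_sqrt)
  then have ratio: "(\<lambda>n. ?w (p n) / ?w n) \<longlonglongrightarrow> 1 / sqrt x"
    using wallis_ratio_pos by (simp add: real_sqrt_divide less_imp_le)
  \<comment> \<open>The scaling \<open>real n - 1\<close> meets the factor \<open>1 / real n\<close>
    of \<open>containment_dist_closed\<close>.\<close>
  have "(\<lambda>n. (real n - 1) / real n * (?w (p n) / ?w n - 1)) \<longlonglongrightarrow> 1 * (1 / sqrt x - 1)"
    by (intro tendsto_intros n1 ratio)
  moreover have "\<forall>\<^sub>F n in sequentially. (real n - 1) / real n * (?w (p n) / ?w n - 1) =
      (real n - 1) * containment_dist n (p n)"
    using eventually_ge_at_top[of 1]
  proof eventually_elim
    case (elim n)
    then have "p n \<le> n" using assms(3)[of n] by simp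
    then show ?case by (simp add: containment_dist_closed)
  qed
  ultimately show ?thesis by (simp add: tendsto_cong)
qed

end
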